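(* Consider noise-free data ($\delta=0$, $y^\delta=y$) and let $\{x_k\}$ be generated by the regularizing hybrid Lanczos trust-region method described in the context, started at $x_0$. Let $\mathcal{L}=\{x\in\mathbb{R}^n : f(x)\le f(x_0)\}$ and assume that, in a neighbourhood of $\mathcal{L}$: (i) there exists $K_J>0$ such that $\|J(x)\|\le K_J$; (ii) the gradient $\nabla f$ is Lipschitz continuous with Lipschitz constant $L$; (iii) $J(x)$ has full rank. Assume moreover that there exists $\varsigma>0$ such that $\varsigma^k_{\ell_k}>\varsigma$ for every $k$, where $\varsigma^k_1\ge\dots\ge\varsigma^k_n$ are the singular values of $J(x_k)$, so that $\varsigma^k_{\ell_k}$ is the $\ell_k$-th of them ($\ell_k$ being the dimension of the Lanczos space chosen at iteration $k$), and that $f$ is bounded below on $\mathcal{L}$. Then $$\liminf_{k\to\infty}\|\nabla f(x_k)\|=0.$$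
   Context: $F:\mathcal{D}(F)\subseteq\mathbb{R}^n\to\mathbb{R}^m$, $m\ge n$, is continuously differentiable with Jacobian $J$; $y\in\mathbb{R}^m$; $f(x)=\frac12\|F(x)-y\|^2$; $\|\cdot\|$ is the 2-norm. At an iterate $x_k$ set $B_k=J(x_k)^TJ(x_k)$, $g_k=\nabla f(x_k)=J(x_k)^T(F(x_k)-y)$. Golub-Kahan-Lanczos bidiagonalization GKLB$(A,q_1,\ell)$, $A\in\mathbb{R}^{m\times n}$, $q_1\neq0$: replace $q_1$ by $q_1/\|q_1\|$, set $\beta_0=0$, and for $j=1,\dots,\ell$: $\tilde p_j=Aq_j-\beta_{j-1}p_{j-1}$, $\alpha_j=\|\tilde p_j\|$, $p_j=\tilde p_j/\alpha_j$, $\tilde q_{j+1}=A^Tp_j-\alpha_jq_j$, $\beta_j=\|\tilde q_{j+1}\|$, $q_{j+1}=\tilde q_{j+1}/\beta_j$. Output: $Q_\ell=[q_1,\dots,q_\ell]\in\mathbb{R}^{n\times\ell}$ (orthonormal columns) and the upper bidiagonal $T_\ell\in\mathbb{R}^{\ell\times\ell}$ with diagonal $\alpha_1,\dots,\alpha_\ell$ and superdiagonal $\beta_1,\dots,\beta_{\ell-1}$. It is assumed that the process is not prematurely halted, i.e. $\alpha_j\ne0$ for $j\le\ell$ and $\beta_j\neq0$ for $j<\ell$. Iteration $k$ of the method (fixed parameters $\eta,\gamma,q\in(0,1)$, $0<C_{\min}<C_{\max}$; the run is assumed well defined; if $g_k=0$ the method stops and one sets $x_j=x_k$ for all $j\ge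 k$): 1. Choose $1\le\ell_k\le n$. 2. Obtain $Q_{\ell_k},T_{\ell_k}$ from GKLB$(J(x_k),g_k,\ell_k)$ and set $\tilde s_k=Q_{\ell_k}(T_{\ell_k}^TT_{\ell_k})^{1/2}Q_{\ell_k}^Tg_k$. 3. Choose $\Delta_k\in\left[C_{\min}\|\tilde s_k\|,\ \min\{C_{\max},(1-q)/\|T_{\ell_k}^TT_{\ell_k}\|^2\}\|\tilde s_k\|\right]$. 4. Repeat: compute $w_k$, with multiplier $\lambda_k\ge0$, solving $\min_{w\in\mathbb{R}^{\ell_k}}\Phi_k(w)$ subject to $\|w\|\le\Delta_k$, where $\Phi_k(w)=\frac12w^T(T_{\ell_k}^TT_{\ell_k})^2w+w^TQ_{\ell_k}^T\tilde s_k+f(x_k)$, i.e. $[(T_{\ell_k}^TT_{\ell_k})^2+\lambda_kI]w_k=-Q_{\ell_k}^T\tilde s_k$, $\lambda_k(\Delta_k-\|w_k\|)=0$, $\|w_k\|\le\Delta_k$; set $z_k=Q_{\ell_k}w_k$, $p_k=Q_{\ell_k}(T_{\ell_k}^TT_{\ell_k})^{1/2}Q_{\ell_k}^Tz_k$, and $$\pi_k(w_k)=\frac{f(x_k)-f(x_k+p_k)}{f(x_k)-\Phi_k(w_k)};$$ if $\pi_k(w_k)<\eta$, replace $\Delta_k$ by $\gamma\Delta_k$. Until $\pi_k(w_k)\ge\eta$. 5. Set $x_{k+1}=x_k+p_k$.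
   Formalization: The neighbourhood in (i)–(iii) is taken to be an open set inside D(F) containing the closure of the level set; this is automatic when D(F) is all of R^n, but without it the claim can fail for general D(F), e.g. R without 0. *)

theory Defs
  imports "HOL-Analysis.Analysis" "Jordan_Normal_Form.Matrix"
begin

unbundle no vec_syntax and no inner_syntax

text \<open>The ambient spaces are \<open>real ^ 'n\<close> and \<open>real ^ 'm\<close>.  Objects living in the Krylov space,
  whose dimension changes with the iteration, are vectors and matrices with explicit dimension
  (\<open>real vec\<close>, \<open>real mat\<close>, indexed from 0), and \<open>\<bullet>\<close> is their scalar product.\<close>

subsection \<open>Least squares problem\<close>

definition lsq :: "(real^'n \<Rightarrow> real^'m) \<Rightarrow> real^'m \<Rightarrow> real^'n \<Rightarrow> real" where
  "lsq F y x = (norm (F x - y))\<^sup>2 / 2"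

definition lsq_grad ::
    "(real^'n \<Rightarrow> real^'m) \<Rightarrow> (real^'n \<Rightarrow> real^'n^'m) \<Rightarrow> real^'m \<Rightarrow> real^'n \<Rightarrow> real^'n" where
  "lsq_grad F J y x = transpose (J x) *v (F x - y)"

lemma lsq_grad_is_gradient:
  fixes F :: "real^'n \<Rightarrow> real^'m"
  assumes "(F has_derivative (\<lambda>h. J x *v h)) (at x within D)"
  shows "(lsq F y has_derivative (\<lambda>h. inner (lsq_grad F J y x) h)) (at x within D)"
proof -
  have eq: "lsq F y = (\<lambda>x. inner (F x - y) (F x - y) / 2)"
    by (simp add: fun_eq_iff lsq_def power2_norm_eq_inner)
  have "((\<lambda>x. inner (F x - y) (F x - y) / 2) has_derivative
      (\<lambda>h. (inner (F x - y) (J x *v h) + inner (J x *v h) (F x - y)) / 2)) (at x within D)"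
    by (auto intro!: derivative_eq_intros assms)
  moreover have "(inner (F x - y) (J x *v h) + inner (J x *v h) (F x - y)) / 2
      = inner (lsq_grad F J y x) h" for h
    by (simp add: lsq_grad_def inner_commute[of "J x *v h"] dot_lmul_matrix)
  ultimately show ?thesis by (simp add: eq)
qed

text \<open>\<open>F\<close> is only defined on \<open>D\<close>, which need not be closed, so neither need this set be; it is
  closed when \<open>D = UNIV\<close> and \<open>F\<close> is continuous.\<close>

definition lsq_level_set ::
    "(real^'n) set \<Rightarrow> (real^'n \<Rightarrow> real^'m) \<Rightarrow> real^'m \<Rightarrow> real^'n \<Rightarrow> (real^'n) set" where
  "lsq_level_set D F y x0 = {x \<in> D. lsq F y x \<le> lsq F y x0}"

text \<open>\<open>\<sigma> 1 \<ge> \<dots> \<ge> \<sigma> n\<close> are the singular values of \<open>A\<close> (with at least as many rows as columns),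
  read off a singular value decomposition \<open>A V = U \<Sigma>\<close> given by the columns of \<open>U\<close>, \<open>V\<close>.\<close>

definition singular_values :: "real^'n^'m \<Rightarrow> (nat \<Rightarrow> real) \<Rightarrow> bool" where
  "singular_values A \<sigma> \<longleftrightarrow>
     (\<forall>i\<in>{1..CARD('n)}. 0 \<le> \<sigma> i) \<and>
     (\<forall>i\<in>{1..CARD('n)}. \<forall>j\<in>{1..CARD('n)}. i \<le> j \<longrightarrow> \<sigma> j \<le> \<sigma> i) \<and>
     (\<exists>(u :: nat \<Rightarrow> real^'m) (v :: nat \<Rightarrow> real^'n).
        (\<forall>i\<in>{1..CARD('n)}. \<forall>j\<in>{1..CARD('n)}. inner (u i) (u j) = (if i = j then 1 else 0)) \<and>
        (\<forall>i\<in>{1..CARD('n)}. \<forall>j\<in>{1..CARD('n)}. inner (v i) (v j) = (if i = j then 1 else 0)) \<and>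
        (\<forall>i\<in>{1..CARD('n)}. A *v v i = \<sigma> i *\<^sub>R u i))"

subsection \<open>Vectors and matrices of varying dimension\<close>

definition vec_norm2 :: "real vec \<Rightarrow> real" where
  "vec_norm2 v = sqrt (v \<bullet> v)"

definition mat_norm2 :: "real mat \<Rightarrow> real" where
  "mat_norm2 M = Sup {vec_norm2 (M *\<^sub>v v) | v. v \<in> carrier_vec (dim_col M) \<and> vec_norm2 v \<le> 1}"

text \<open>\<open>S\<close> is the symmetric positive semidefinite square root of \<open>M\<close>.\<close>

definition psd_sqrt :: "real mat \<Rightarrow> real mat \<Rightarrow> bool" where
  "psd_sqrt M S \<longleftrightarrow>
     S \<in> carrier_mat (dim_row M) (dim_row M) \<and> transpose_mat S = S \<and>
     (\<forall>v \<in> carrier_vec (dim_row M). 0 \<le> v \<bullet> (S *\<^sub>v v)) \<and> S * S = M"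

text \<open>For the matrix with columns \<open>Q 1, \<dots>, Q l\<close>: multiplication by it and by its transpose.\<close>

definition cols_mult :: "nat \<Rightarrow> (nat \<Rightarrow> real^'n) \<Rightarrow> real vec \<Rightarrow> real^'n" where
  "cols_mult l Q w = (\<Sum>i<l. (w $ i) *\<^sub>R Q (Suc i))"

definition cols_mult_transpose :: "nat \<Rightarrow> (nat \<Rightarrow> real^'n) \<Rightarrow> real^'n \<Rightarrow> real vec" where
  "cols_mult_transpose l Q v = Matrix.vec l (\<lambda>i. inner (Q (Suc i)) v)"

subsection \<open>Golub--Kahan--Lanczos bidiagonalization\<close>

text \<open>\<open>\<alpha>\<close>, \<open>\<beta>\<close>, \<open>P\<close>, \<open>Q\<close> are the quantities produced by \<open>l\<close> steps from the starting vector \<open>q1\<close>,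
  which does not have to be normalized; the process is not prematurely halted.  \<open>\<beta> l\<close> may vanish,
  in which case \<open>Q (l + 1)\<close> is meaningless but not used; \<open>P 0\<close> is irrelevant since \<open>\<beta> 0 = 0\<close>.\<close>

definition gklb ::
    "real^'n^'m \<Rightarrow> real^'n \<Rightarrow> nat \<Rightarrow> (nat \<Rightarrow> real) \<Rightarrow> (nat \<Rightarrow> real) \<Rightarrow>
     (nat \<Rightarrow> real^'m) \<Rightarrow> (nat \<Rightarrow> real^'n) \<Rightarrow> bool" where
  "gklb A q1 l \<alpha> \<beta> P Q \<longleftrightarrow>
     Q 1 = (1 / norm q1) *\<^sub>R q1 \<and> \<beta> 0 = 0 \<and>
     (\<forall>j\<in>{1..l}.
        \<alpha> j = norm (A *v Q j - \<beta> (j - 1) *\<^sub>R P (j - 1)) \<and>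
        P j = (1 / \<alpha> j) *\<^sub>R (A *v Q j - \<beta> (j - 1) *\<^sub>R P (j - 1)) \<and>
        \<beta> j = norm (transpose A *v P j - \<alpha> j *\<^sub>R Q j) \<and>
        Q (j + 1) = (1 / \<beta> j) *\<^sub>R (transpose A *v P j - \<alpha> j *\<^sub>R Q j)) \<and>
     (\<forall>j\<in>{1..l}. \<alpha> j \<noteq> 0) \<and> (\<forall>j\<in>{1..<l}. \<beta> j \<noteq> 0)"

definition gklb_mat :: "nat \<Rightarrow> (nat \<Rightarrow> real) \<Rightarrow> (nat \<Rightarrow> real) \<Rightarrow> real mat" where
  "gklb_mat l \<alpha> \<beta> = Matrix.mat l l (\<lambda>(i, j).
     if j = i then \<alpha> (Suc i) else if j = Suc i then \<beta> (Suc i) else 0)"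

subsection \<open>Trust-region subproblem\<close>

text \<open>With \<open>H = T\<^sup>T T\<close>, \<open>b = Q\<^sup>T s\<close> and \<open>c = f(x)\<close> this is the model \<open>\<Phi>\<close>.\<close>

definition tr_model :: "real mat \<Rightarrow> real vec \<Rightarrow> real \<Rightarrow> real vec \<Rightarrow> real" where
  "tr_model H b c w = 1 / 2 * (w \<bullet> ((H * H) *\<^sub>v w)) + w \<bullet> b + c"

definition tr_solution ::
    "nat \<Rightarrow> real mat \<Rightarrow> real vec \<Rightarrow> real \<Rightarrow> real \<Rightarrow> real vec \<Rightarrow> real \<Rightarrow> bool" where
  "tr_solution l H b c \<Delta> w \<mu> \<longleftrightarrow>
     w \<in> carrier_vec l \<and> vec_norm2 w \<le> \<Delta> \<and>
     (\<forall>v\<in>carrier_vec l. vec_norm2 v \<le> \<Delta> \<longrightarrow> tr_model H b c w \<le> tr_model H b c v) \<and>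
     0 \<le> \<mu> \<and> (H * H + \<mu> \<cdot>\<^sub>m 1\<^sub>m l) *\<^sub>v w = - b \<and> \<mu> * (\<Delta> - vec_norm2 w) = 0"

subsection \<open>The method\<close>

text \<open>One iteration from \<open>x\<close> to \<open>x'\<close> with Krylov dimension \<open>l\<close>.  \<open>\<Delta>\<close> is the initial radius,
  \<open>w i\<close> and \<open>\<mu> i\<close> solve the subproblem after \<open>i\<close> reductions of the radius, and the step is
  accepted after exactly \<open>N\<close> reductions.  Well-definedness of the run requires all trial points
  to lie in the domain \<open>D\<close> of \<open>F\<close>.\<close>

definition lanczos_tr_step ::
    "(real^'n) set \<Rightarrow> (real^'n \<Rightarrow> real^'m) \<Rightarrow> (real^'n \<Rightarrow> real^'n^'m) \<Rightarrow> real^'m \<Rightarrow>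
     real \<Rightarrow> real \<Rightarrow> real \<Rightarrow> real \<Rightarrow> real \<Rightarrow> nat \<Rightarrow> real^'n \<Rightarrow> real^'n \<Rightarrow> bool" where
  "lanczos_tr_step D F J y \<eta> \<gamma> q Cmin Cmax l x x' \<longleftrightarrow>
     1 \<le> l \<and> l \<le> CARD('n) \<and>
     (\<exists>\<alpha> \<beta> P Q S \<Delta> N w \<mu>.
        let f = lsq F y;
            g = lsq_grad F J y x;
            T = gklb_mat l \<alpha> \<beta>;
            H = transpose_mat T * T;
            R = (\<lambda>v. cols_mult l Q (S *\<^sub>v cols_mult_transpose l Q v));
            s = R g;
            b = cols_mult_transpose l Q s;
            \<Phi> = tr_model H b (f x);
            p = (\<lambda>i. R (cols_mult l Q (w i)));
            \<pi> = (\<lambda>i. (f x - f (x + p i)) / (f x - \<Phi> (w i)))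
        in gklb (J x) g l \<alpha> \<beta> P Q \<and>
           psd_sqrt H S \<and>
           Cmin * norm s \<le> \<Delta> \<and>
           \<Delta> \<le> min Cmax ((1 - q) / (mat_norm2 H)\<^sup>2) * norm s \<and>
           (\<forall>i\<le>N. tr_solution l H b (f x) (\<gamma> ^ i * \<Delta>) (w i) (\<mu> i) \<and> x + p i \<in> D) \<and>
           (\<forall>i<N. \<pi> i < \<eta>) \<and> \<pi> N \<ge> \<eta> \<and>
           x' = x + p N)"

definition lanczos_tr_run ::
    "(real^'n) set \<Rightarrow> (real^'n \<Rightarrow> real^'m) \<Rightarrow> (real^'n \<Rightarrow> real^'n^'m) \<Rightarrow> real^'m \<Rightarrow>
     real \<Rightarrow> real \<Rightarrow> real \<Rightarrow> real \<Rightarrow> real \<Rightarrow> (nat \<Rightarrow> nat) \<Rightarrow> (nat \<Rightarrow> real^'n) \<Rightarrow> bool" where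
  "lanczos_tr_run D F J y \<eta> \<gamma> q Cmin Cmax l x \<longleftrightarrow>
     x 0 \<in> D \<and>
     (\<forall>k. if lsq_grad F J y (x k) = 0 then x (Suc k) = x k
          else lanczos_tr_step D F J y \<eta> \<gamma> q Cmin Cmax (l k) (x k) (x (Suc k)))"

end

theory Submission
  imports Defs
begin

text \<open>Every quantity of the subproblem, although computed in the Krylov space, has a meaning in the
  ambient space.  Write \<open>g\<close> for the gradient, \<open>A\<close> for the Jacobian at the iterate and \<open>S\<close> for the
  square root of \<open>T\<^sup>T T\<close>.  Since \<open>A Q = P T\<close> with orthonormal columns in \<open>P\<close> and \<open>Q\<close>
  (\<open>gklb_mult_cols_mult\<close>, \<open>gklb_orthonormal\<close>), one has \<open>\<parallel>S v\<parallel> = \<parallel>T v\<parallel> = \<parallel>A Q v\<parallel>\<close>.  The Krylov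
  space contains \<open>g\<close>, so the linear term of the model has norm \<open>\<parallel>A g\<parallel>\<close>; the step \<open>p = Q S w\<close>
  satisfies \<open>\<parallel>p\<parallel> = \<parallel>A Q w\<parallel> \<le> K \<Delta>\<close>; and the linear term evaluated at \<open>w\<close> is exactly \<open>\<langle>g, p\<rangle>\<close>.

  The upper bound on the initial radius says that the Cauchy step is never stopped by the curvature
  of the model, so the predicted reduction is at least \<open>\<Delta> \<parallel>A g\<parallel> / 2\<close> (\<open>tr_solution_reduction\<close>).
  Beyond the model, \<open>f\<close> grows by at most \<open>L \<parallel>p\<parallel>\<^sup>2 / 2\<close>, which is of order \<open>\<Delta>\<^sup>2\<close>.  Hence a radius below a
  fixed multiple of \<open>\<parallel>A g\<parallel>\<close> is never rejected, the accepted radius is bounded below by a multiple of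
  \<open>\<parallel>A g\<parallel>\<close>, and \<open>f\<close> decreases by at least a multiple of \<open>\<parallel>A g\<parallel>\<^sup>2\<close> (\<open>lanczos_tr_step_decrease\<close>).

  It remains to bound \<open>\<parallel>A g\<parallel>\<close> below by the gradient, uniformly in the iteration.  Because
  \<open>g = A\<^sup>T (F x - y)\<close>, moving \<open>A\<close> across the inner product gives
  \<open>\<parallel>g\<parallel>\<^sup>2 \<le> \<parallel>F x - y\<parallel> \<parallel>A g\<parallel>\<close> (\<open>norm_lsq_grad_le\<close>), and the residual norms do not increase along the run.  So
  \<open>f\<close> drops by at least a multiple of \<open>\<parallel>g\<parallel>\<^sup>4\<close> in each iteration.  As \<open>f \<ge> 0\<close>, these fourth powers are
  summable, and the whole sequence of gradients tends to zero.\<close>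

section \<open>Euclidean norms of vectors and matrices of explicit dimension\<close>

lemma vec_norm2_nonneg: "0 \<le> vec_norm2 v"
  by (simp add: vec_norm2_def scalar_prod_def sum_nonneg)

lemma vec_norm2_power2: "(vec_norm2 v)\<^sup>2 = v \<bullet> v"
  by (simp add: vec_norm2_def scalar_prod_def sum_nonneg)

lemma vec_norm2_smult: "vec_norm2 (c \<cdot>\<^sub>v v) = \<bar>c\<bar> * vec_norm2 v"
proof -
  have "(c \<cdot>\<^sub>v v) \<bullet> (c \<cdot>\<^sub>v v) = c\<^sup>2 * (v \<bullet> v)"
    by (simp add: scalar_prod_def sum_distrib_left power2_eq_square algebra_simps)
  then show ?thesis by (simp add: vec_norm2_def real_sqrt_mult)
qed

lemma vec_norm2_L2_set: "vec_norm2 v = L2_set (\<lambda>i. v $ i) {0..<dim_vec v}"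
  by (simp add: vec_norm2_def scalar_prod_def L2_set_def power2_eq_square)

lemma vec_Cauchy_Schwarz:
  assumes "dim_vec u = dim_vec v"
  shows "\<bar>u \<bullet> v\<bar> \<le> vec_norm2 u * vec_norm2 v"
proof -
  have "\<bar>u \<bullet> v\<bar> \<le> (\<Sum>i\<in>{0..<dim_vec v}. \<bar>u $ i\<bar> * \<bar>v $ i\<bar>)"
    unfolding scalar_prod_def by (rule order.trans[OF sum_abs]) (simp add: abs_mult)
  also have "\<dots> \<le> vec_norm2 u * vec_norm2 v"
    unfolding vec_norm2_L2_set assms by (rule L2_set_mult_ineq)
  finally show ?thesis .
qed

lemma vec_norm2_mult_mat_vec_le_rows:
  assumes v: "v \<in> carrier_vec (dim_col M)"
  shows "vec_norm2 (M *\<^sub>v v) \<le> (\<Sum>i\<in>{0..<dim_row M}. vec_norm2 (row M i)) * vec_norm2 v"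
proof -
  have "vec_norm2 (M *\<^sub>v v) \<le> (\<Sum>i\<in>{0..<dim_row M}. \<bar>(M *\<^sub>v v) $ i\<bar>)"
    unfolding vec_norm2_L2_set using L2_set_le_sum_abs[of "($) (M *\<^sub>v v)"]
    by (simp only: dim_mult_mat_vec)
  also have "\<dots> \<le> (\<Sum>i\<in>{0..<dim_row M}. vec_norm2 (row M i) * vec_norm2 v)"
  proof (rule sum_mono)
    fix i assume "i \<in> {0..<dim_row M}"
    then show "\<bar>(M *\<^sub>v v) $ i\<bar> \<le> vec_norm2 (row M i) * vec_norm2 v"
      using v vec_Cauchy_Schwarz[of "row M i" v] by simp
  qed
  finally show ?thesis by (simp add: sum_distrib_right)
qed

text \<open>The supremum defining the spectral norm only says something once the set is known to be
  bounded.\<close>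

lemma mat_norm2_bdd_above:
  "bdd_above {vec_norm2 (M *\<^sub>v v) | v. v \<in> carrier_vec (dim_col M) \<and> vec_norm2 v \<le> 1}"
proof (rule bdd_aboveI)
  fix a assume "a \<in> {vec_norm2 (M *\<^sub>v v) | v. v \<in> carrier_vec (dim_col M) \<and> vec_norm2 v \<le> 1}"
  then obtain v where v: "v \<in> carrier_vec (dim_col M)" "vec_norm2 v \<le> 1"
    and a: "a = vec_norm2 (M *\<^sub>v v)" by blast
  have "a \<le> (\<Sum>i\<in>{0..<dim_row M}. vec_norm2 (row M i)) * vec_norm2 v"
    unfolding a by (rule vec_norm2_mult_mat_vec_le_rows[OF v(1)])
  also have "\<dots> \<le> (\<Sum>i\<in>{0..<dim_row M}. vec_norm2 (row M i)) * 1"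
    by (intro mult_left_mono v sum_nonneg vec_norm2_nonneg)
  finally show "a \<le> (\<Sum>i\<in>{0..<dim_row M}. vec_norm2 (row M i)) * 1" .
qed

lemma vec_norm2_mult_mat_vec_le:
  assumes v: "v \<in> carrier_vec (dim_col M)"
  shows "vec_norm2 (M *\<^sub>v v) \<le> mat_norm2 M * vec_norm2 v"
proof (cases "vec_norm2 v = 0")
  case True
  then show ?thesis using vec_norm2_mult_mat_vec_le_rows[OF v] by simp
next
  case False
  then have pos: "0 < vec_norm2 v" using vec_norm2_nonneg[of v] by simp
  define u where "u = (1 / vec_norm2 v) \<cdot>\<^sub>v v"
  have "u \<in> carrier_vec (dim_col M)" "vec_norm2 u \<le> 1"
    using v pos by (auto simp: u_def vec_norm2_smult)
  then have "vec_norm2 (M *\<^sub>v u) \<le> mat_norm2 M"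
    unfolding mat_norm2_def by (intro cSup_upper mat_norm2_bdd_above) auto
  moreover have "vec_norm2 (M *\<^sub>v u) = vec_norm2 (M *\<^sub>v v) / vec_norm2 v"
    using v pos mult_mat_vec[of M "dim_row M" "dim_col M" v "1 / vec_norm2 v"]
    by (simp add: u_def vec_norm2_smult)
  ultimately show ?thesis using pos by (simp add: field_simps)
qed

lemma scalar_prod_mult_mat_vec:
  fixes M :: "real mat"
  assumes "M \<in> carrier_mat n l" "u \<in> carrier_vec n" "v \<in> carrier_vec l"
  shows "u \<bullet> (M *\<^sub>v v) = (transpose_mat M *\<^sub>v u) \<bullet> v"
  using assms transpose_vec_mult_scalar[of M n l v u] by simp

lemma scalar_prod_gram:
  fixes M :: "real mat"
  assumes M: "M \<in> carrier_mat n l" and v: "v \<in> carrier_vec l"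
  shows "v \<bullet> ((transpose_mat M * M) *\<^sub>v v) = (vec_norm2 (M *\<^sub>v v))\<^sup>2"
proof -
  have "(transpose_mat M * M) *\<^sub>v v = transpose_mat M *\<^sub>v (M *\<^sub>v v)"
    using M v by simp
  then show ?thesis
    using M v scalar_prod_mult_mat_vec[of "transpose_mat M" l n v "M *\<^sub>v v"]
    by (simp add: vec_norm2_power2)
qed

section \<open>Golub--Kahan--Lanczos bidiagonalization\<close>

definition orthonormal_upto :: "nat \<Rightarrow> (nat \<Rightarrow> 'a::real_inner) \<Rightarrow> bool" where
  "orthonormal_upto l Q \<longleftrightarrow>
     (\<forall>i\<in>{1..l}. \<forall>j\<in>{1..l}. inner (Q i) (Q j) = (if i = j then 1 else 0))"

lemma orthonormal_uptoD:
  assumes "orthonormal_upto l Q" "1 \<le> i" "i \<le> l" "1 \<le> j" "j \<le> l"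
  shows "inner (Q i) (Q j) = (if i = j then 1 else 0)"
  using assms by (auto simp: orthonormal_upto_def)

lemma orthonormal_upto_Suc:
  assumes "orthonormal_upto l Q" "inner (Q (Suc l)) (Q (Suc l)) = 1"
    "\<And>i. 1 \<le> i \<Longrightarrow> i \<le> l \<Longrightarrow> inner (Q (Suc l)) (Q i) = 0"
  shows "orthonormal_upto (Suc l) Q"
  using assms by (auto simp: orthonormal_upto_def atLeastAtMostSuc_conv inner_commute)

lemma inner_transpose_mult:
  fixes A :: "real^'n^'m"
  shows "inner (transpose A *v u) v = inner u (A *v v)"
  by (simp add: dot_lmul_matrix)

context
  fixes A :: "real^'n^'m" and q1 :: "real^'n" and l \<alpha> \<beta> P Q
  assumes gklb: "gklb A q1 l \<alpha> \<beta> P Q" and q1: "q1 \<noteq> 0"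
begin

lemma gklb_alpha: "1 \<le> j \<Longrightarrow> j \<le> l \<Longrightarrow> \<alpha> j \<noteq> 0"
  using gklb unfolding gklb_def by (meson atLeastAtMost_iff)

lemma gklb_beta: "1 \<le> j \<Longrightarrow> j < l \<Longrightarrow> \<beta> j \<noteq> 0"
  using gklb unfolding gklb_def by (meson atLeastLessThan_iff)

lemma gklb_beta0: "\<beta> 0 = 0"
  using gklb unfolding gklb_def by blast

lemma gklb_recurrence:
  assumes "1 \<le> j" "j \<le> l"
  shows "\<alpha> j = norm (A *v Q j - \<beta> (j - 1) *\<^sub>R P (j - 1))"
    and "P j = (1 / \<alpha> j) *\<^sub>R (A *v Q j - \<beta> (j - 1) *\<^sub>R P (j - 1))"
    and "\<beta> j = norm (transpose A *v P j - \<alpha> j *\<^sub>R Q j)"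
    and "Q (Suc j) = (1 / \<beta> j) *\<^sub>R (transpose A *v P j - \<alpha> j *\<^sub>R Q j)"
proof -
  have "j \<in> {1..l}" using assms by simp
  with gklb show
    "\<alpha> j = norm (A *v Q j - \<beta> (j - 1) *\<^sub>R P (j - 1))"
    "P j = (1 / \<alpha> j) *\<^sub>R (A *v Q j - \<beta> (j - 1) *\<^sub>R P (j - 1))"
    "\<beta> j = norm (transpose A *v P j - \<alpha> j *\<^sub>R Q j)"
    "Q (Suc j) = (1 / \<beta> j) *\<^sub>R (transpose A *v P j - \<alpha> j *\<^sub>R Q j)"
    unfolding gklb_def Suc_eq_plus1 by blast+
qed

lemma gklb_mult:
  assumes "1 \<le> j" "j \<le> l"
  shows "A *v Q j = \<alpha> j *\<^sub>R P j + \<beta> (j - 1) *\<^sub>R P (j - 1)"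
proof -
  have "\<alpha> j *\<^sub>R P j = A *v Q j - \<beta> (j - 1) *\<^sub>R P (j - 1)"
    using gklb_alpha[OF assms] by (subst gklb_recurrence(2)[OF assms]) simp
  then show ?thesis by simp
qed

text \<open>The case \<open>j = l\<close> is included although \<open>\<beta> l\<close> may vanish: then \<open>Q (l + 1)\<close> is multiplied by
  zero.\<close>

lemma gklb_transpose_mult:
  assumes "1 \<le> j" "j \<le> l"
  shows "transpose A *v P j = \<alpha> j *\<^sub>R Q j + \<beta> j *\<^sub>R Q (Suc j)"
proof -
  have "\<beta> j *\<^sub>R Q (Suc j) = transpose A *v P j - \<alpha> j *\<^sub>R Q j"
  proof (cases "\<beta> j = 0")
    case True
    then have "transpose A *v P j - \<alpha> j *\<^sub>R Q j = 0"
      using gklb_recurrence(3)[OF assms] by (metis norm_eq_zero)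
    then show ?thesis using True by (metis scaleR_zero_left)
  next
    case False
    then show ?thesis by (subst gklb_recurrence(4)[OF assms]) simp
  qed
  then show ?thesis by simp
qed

lemma gklb_norm_P:
  assumes "1 \<le> j" "j \<le> l"
  shows "norm (P j) = 1"
proof -
  have "norm (\<alpha> j *\<^sub>R P j) = \<alpha> j"
    using gklb_recurrence(1)[OF assms] gklb_mult[OF assms] by (metis add_diff_cancel_right')
  moreover have "0 \<le> \<alpha> j" by (subst gklb_recurrence(1)[OF assms]) (rule norm_ge_zero)
  ultimately show ?thesis using gklb_alpha[OF assms] by simp
qed

lemma gklb_norm_Q:
  assumes "1 \<le> j" "j \<le> l"
  shows "norm (Q j) = 1"
proof (cases "j = 1")
  case True
  have "Q 1 = (1 / norm q1) *\<^sub>R q1" using gklb unfolding gklb_def by blast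
  then show ?thesis using True q1 by simp
next
  case False
  then obtain i where j: "j = Suc i" and i: "1 \<le> i" "i < l"
    using assms by (cases j) auto
  then have i': "i \<le> l" by simp
  have "norm (\<beta> i *\<^sub>R Q (Suc i)) = \<beta> i"
    using gklb_recurrence(3)[OF i(1) i'] gklb_transpose_mult[OF i(1) i']
    by (metis add_diff_cancel_left')
  moreover have "0 \<le> \<beta> i" by (subst gklb_recurrence(3)[OF i(1) i']) (rule norm_ge_zero)
  ultimately show ?thesis using gklb_beta[OF i] j by simp
qed

text \<open>Each new vector is orthogonal to its predecessors because the two short recurrences are
  adjoint to one another: testing one of them against an old vector and moving \<open>A\<close> across the
  inner product lands in the other, where orthogonality is already known.\<close>

lemma gklb_orthonormal_aux:
  assumes "j \<le> l"
  shows "orthonormal_upto j Q \<and> orthonormal_upto j P"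
  using assms
proof (induction j)
  case 0
  then show ?case by (simp add: orthonormal_upto_def)
next
  case (Suc j)
  then have IQ: "orthonormal_upto j Q" and IP: "orthonormal_upto j P" and j: "Suc j \<le> l"
    by auto
  have Q_new: "inner (Q (Suc j)) (Q i) = 0" if i: "1 \<le> i" "i \<le> j" for i
  proof -
    have "inner (P j) (P (i - 1)) = 0 \<or> \<beta> (i - 1) = 0"
      using i gklb_beta0 orthonormal_uptoD[OF IP, of j "i - 1"] by (cases "i = 1") auto
    then have "inner (P j) (A *v Q i) = \<alpha> i * (if i = j then 1 else 0)"
      using i j orthonormal_uptoD[OF IP, of j i]
      by (auto simp: gklb_mult inner_add_right)
    moreover have "inner (P j) (A *v Q i) = inner (\<alpha> j *\<^sub>R Q j + \<beta> j *\<^sub>R Q (Suc j)) (Q i)"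
      using i j gklb_transpose_mult[of j] by (simp flip: inner_transpose_mult)
    moreover have "inner (Q j) (Q i) = (if i = j then 1 else 0)"
      using i orthonormal_uptoD[OF IQ, of j i] by auto
    ultimately have "\<beta> j * inner (Q (Suc j)) (Q i) = 0"
      by (auto simp: inner_add_left split: if_splits)
    then show ?thesis using gklb_beta[of j] i j by simp
  qed
  have Q': "orthonormal_upto (Suc j) Q"
    using IQ Q_new gklb_norm_Q[of "Suc j"] j
    by (intro orthonormal_upto_Suc) (auto simp: dot_square_norm)
  have P_new: "inner (P (Suc j)) (P i) = 0" if i: "1 \<le> i" "i \<le> j" for i
  proof -
    have "inner (A *v Q (Suc j)) (P i) = inner (Q (Suc j)) (\<alpha> i *\<^sub>R Q i + \<beta> i *\<^sub>R Q (Suc i))"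
      using i j gklb_transpose_mult[of i] inner_transpose_mult[of A "P i" "Q (Suc j)"]
      by (simp add: inner_commute)
    also have "\<dots> = \<beta> i * (if i = j then 1 else 0)"
      using i orthonormal_uptoD[OF Q', of "Suc j" i] orthonormal_uptoD[OF Q', of "Suc j" "Suc i"]
      by (auto simp: inner_add_right)
    finally have "inner (\<alpha> (Suc j) *\<^sub>R P (Suc j) + \<beta> j *\<^sub>R P j) (P i)
        = \<beta> i * (if i = j then 1 else 0)"
      using gklb_mult[of "Suc j"] j by simp
    moreover have "inner (P j) (P i) = (if i = j then 1 else 0)"
      using i orthonormal_uptoD[OF IP, of j i] by auto
    ultimately have "\<alpha> (Suc j) * inner (P (Suc j)) (P i) = 0"
      by (auto simp: inner_add_left split: if_splits)
    then show ?thesis using gklb_alpha[of "Suc j"] j by simp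
  qed
  have "orthonormal_upto (Suc j) P"
    using IP P_new gklb_norm_P[of "Suc j"] j
    by (intro orthonormal_upto_Suc) (auto simp: dot_square_norm)
  with Q' show ?case ..
qed

lemma gklb_orthonormal: "orthonormal_upto l Q" "orthonormal_upto l P"
  using gklb_orthonormal_aux[of l] by auto

text \<open>The identity \<open>A Q = P T\<close>.\<close>

lemma gklb_mult_cols_mult:
  assumes w: "w \<in> carrier_vec l"
  shows "A *v cols_mult l Q w = cols_mult l P (gklb_mat l \<alpha> \<beta> *\<^sub>v w)"
proof -
  have T: "(gklb_mat l \<alpha> \<beta> *\<^sub>v w) $ i
      = \<alpha> (Suc i) * w $ i + (if Suc i < l then \<beta> (Suc i) * w $ Suc i else 0)"
    if "i < l" for i
  proof -
    have "(gklb_mat l \<alpha> \<beta> *\<^sub>v w) $ i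
        = (\<Sum>j\<in>{0..<l}. (if j = i then \<alpha> (Suc i) * w $ i else 0)
            + (if j = Suc i then \<beta> (Suc i) * w $ Suc i else 0))"
      using that w by (auto simp: gklb_mat_def scalar_prod_def intro!: sum.cong)
    then show ?thesis using that by (simp add: sum.distrib)
  qed
  have "A *v cols_mult l Q w = (\<Sum>i<l. (w $ i) *\<^sub>R (A *v Q (Suc i)))"
    unfolding cols_mult_def
    by (simp add: linear_sum[OF matrix_vector_mul_linear] matrix_vector_mult_scaleR)
  also have "\<dots> = (\<Sum>i<l. (\<alpha> (Suc i) * w $ i) *\<^sub>R P (Suc i)) + (\<Sum>i<l. (\<beta> i * w $ i) *\<^sub>R P i)"
    by (simp add: gklb_mult scaleR_add_right sum.distrib mult.commute)
  also have "(\<Sum>i<l. (\<beta> i * w $ i) *\<^sub>R P i)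
      = (\<Sum>i<l. (if Suc i < l then \<beta> (Suc i) * w $ Suc i else 0) *\<^sub>R P (Suc i))"
  proof (cases l)
    case (Suc k)
    have "(\<Sum>i<Suc k. (\<beta> i * w $ i) *\<^sub>R P i) = (\<Sum>i<k. (\<beta> (Suc i) * w $ Suc i) *\<^sub>R P (Suc i))"
      by (subst sum.lessThan_Suc_shift) (simp add: gklb_beta0)
    then show ?thesis using Suc by simp
  qed simp
  also have "(\<Sum>i<l. (\<alpha> (Suc i) * w $ i) *\<^sub>R P (Suc i)) + \<dots>
      = cols_mult l P (gklb_mat l \<alpha> \<beta> *\<^sub>v w)"
    unfolding cols_mult_def
    by (simp add: T scaleR_add_left flip: sum.distrib)
  finally show ?thesis .
qed

end

lemma inner_cols_mult:
  assumes "v \<in> carrier_vec l"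
  shows "inner (cols_mult l Q v) g = v \<bullet> cols_mult_transpose l Q g"
  using assms
  by (simp add: cols_mult_def cols_mult_transpose_def scalar_prod_def inner_sum_left
      atLeast0LessThan)

lemma cols_mult_transpose_carrier [simp]: "cols_mult_transpose l Q g \<in> carrier_vec l"
  by (simp add: cols_mult_transpose_def)

lemma cols_mult_transpose_cols_mult:
  assumes Q: "orthonormal_upto l Q" and v: "v \<in> carrier_vec l"
  shows "cols_mult_transpose l Q (cols_mult l Q v) = v"
proof (rule eq_vecI)
  fix i assume "i < dim_vec v"
  then have i: "i < l" using v by simp
  have "inner (Q (Suc i)) (cols_mult l Q v) = (\<Sum>j<l. if j = i then v $ j else 0)"
    unfolding cols_mult_def inner_sum_right
    using i by (intro sum.cong) (auto simp: orthonormal_uptoD[OF Q])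
  also have "\<dots> = v $ i" using i by simp
  finally show "cols_mult_transpose l Q (cols_mult l Q v) $ i = v $ i"
    using i by (simp add: cols_mult_transpose_def)
qed (use v in \<open>simp add: cols_mult_transpose_def\<close>)

lemma norm_cols_mult:
  assumes Q: "orthonormal_upto l Q" and v: "v \<in> carrier_vec l"
  shows "norm (cols_mult l Q v) = vec_norm2 v"
  using inner_cols_mult[OF v, of Q "cols_mult l Q v"] cols_mult_transpose_cols_mult[OF Q v]
  by (simp add: norm_eq_sqrt_inner vec_norm2_def)

text \<open>The starting vector is a multiple of \<open>Q 1\<close>, so projecting it on the Krylov space loses nothing.\<close>

lemma cols_mult_transpose_start:
  assumes gklb: "gklb A g l \<alpha> \<beta> P Q" and g: "g \<noteq> 0" and l: "1 \<le> l"
  shows "cols_mult l Q (cols_mult_transpose l Q g) = g"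
proof -
  have "Q 1 = (1 / norm g) *\<^sub>R g" using gklb unfolding gklb_def by blast
  then have Q1: "norm g *\<^sub>R Q 1 = g" using g by simp
  define e where "e = norm g \<cdot>\<^sub>v unit_vec l 0"
  have e: "e \<in> carrier_vec l" by (simp add: e_def)
  have "cols_mult l Q e = (\<Sum>i<l. if i = 0 then norm g *\<^sub>R Q 1 else 0)"
    unfolding cols_mult_def by (intro sum.cong) (auto simp: e_def)
  also have "\<dots> = g" using l Q1 by simp
  finally have "cols_mult l Q e = g" .
  then show ?thesis
    using cols_mult_transpose_cols_mult[OF gklb_orthonormal(1)[OF gklb g] e] by simp
qed

section \<open>The projected trust-region subproblem\<close>

lemma psd_sqrt_carrier:
  "psd_sqrt H S \<Longrightarrow> H \<in> carrier_mat l l \<Longrightarrow> S \<in> carrier_mat l l"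
  by (auto simp: psd_sqrt_def)

text \<open>\<open>S\<close> and \<open>T\<close> have the same Gram matrix, \<open>S\<^sup>T S = S\<^sup>2 = T\<^sup>T T\<close>.\<close>

lemma psd_sqrt_norm:
  assumes S: "psd_sqrt (transpose_mat T * T) S" and T: "T \<in> carrier_mat l l"
    and v: "v \<in> carrier_vec l"
  shows "vec_norm2 (S *\<^sub>v v) = vec_norm2 (T *\<^sub>v v)"
proof -
  have Sc: "S \<in> carrier_mat l l" using psd_sqrt_carrier[OF S] T by simp
  have "(vec_norm2 (S *\<^sub>v v))\<^sup>2 = v \<bullet> ((transpose_mat S * S) *\<^sub>v v)"
    using scalar_prod_gram[OF Sc v] by simp
  also have "transpose_mat S * S = transpose_mat T * T"
    using S by (simp add: psd_sqrt_def)
  finally show ?thesis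
    using scalar_prod_gram[OF T v] by (simp add: vec_norm2_nonneg)
qed

text \<open>With \<open>H\<close> symmetric, the quadratic form of \<open>H\<^sup>2\<close> is a squared norm.\<close>

lemma tr_model_eq:
  assumes H: "H \<in> carrier_mat l l" "transpose_mat H = H" and w: "w \<in> carrier_vec l"
  shows "tr_model H b c w = (vec_norm2 (H *\<^sub>v w))\<^sup>2 / 2 + w \<bullet> b + c"
  using scalar_prod_gram[OF H(1) w] H(2) by (simp add: tr_model_def)

text \<open>The solution does at least as well as the step of length \<open>\<Delta>\<close> along \<open>- b\<close>.  When \<open>\<Delta>\<close> is at
  most \<open>\<parallel>b\<parallel> / \<parallel>H\<parallel>\<^sup>2\<close>, the quadratic term there costs at most half of the linear gain.\<close>

lemma tr_solution_reduction:
  assumes H: "H \<in> carrier_mat l l" "transpose_mat H = H" and b: "b \<in> carrier_vec l"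
    and sol: "tr_solution l H b c \<Delta> w \<mu>"
    and radius: "0 \<le> \<Delta>" "(mat_norm2 H)\<^sup>2 * \<Delta> \<le> vec_norm2 b"
  shows "vec_norm2 b * \<Delta> / 2 \<le> c - tr_model H b c w"
proof -
  (* For b = 0 the convention 1 / 0 = 0 makes v the zero vector, which serves as well. *)
  define v where "v = (- \<Delta> / vec_norm2 b) \<cdot>\<^sub>v b"
  have v: "v \<in> carrier_vec l" using b by (simp add: v_def)
  have norm_v: "vec_norm2 v \<le> \<Delta>"
    using radius vec_norm2_nonneg[of b]
    by (cases "vec_norm2 b = 0") (simp_all add: v_def vec_norm2_smult)
  have "v \<bullet> b = - \<Delta> / vec_norm2 b * (vec_norm2 b)\<^sup>2"
    using b by (simp add: v_def vec_norm2_power2)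
  then have vb: "v \<bullet> b = - \<Delta> * vec_norm2 b"
    by (cases "vec_norm2 b = 0") (simp_all add: power2_eq_square)
  have "vec_norm2 (H *\<^sub>v v) \<le> mat_norm2 H * vec_norm2 v"
    using H v by (intro vec_norm2_mult_mat_vec_le) simp
  then have "(vec_norm2 (H *\<^sub>v v))\<^sup>2 \<le> (mat_norm2 H * vec_norm2 v)\<^sup>2"
    by (intro power_mono vec_norm2_nonneg)
  also have "\<dots> \<le> (mat_norm2 H * \<Delta>)\<^sup>2"
    unfolding power_mult_distrib
    by (intro mult_left_mono power_mono norm_v vec_norm2_nonneg) simp
  also have "\<dots> = (mat_norm2 H)\<^sup>2 * \<Delta> * \<Delta>" by (simp add: power2_eq_square)
  also have "\<dots> \<le> vec_norm2 b * \<Delta>" by (intro mult_right_mono radius)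
  finally have "tr_model H b c v \<le> c - vec_norm2 b * \<Delta> / 2"
    using H v vb by (simp add: tr_model_eq algebra_simps)
  moreover have "tr_model H b c w \<le> tr_model H b c v"
    using sol v norm_v by (auto simp: tr_solution_def)
  ultimately show ?thesis by simp
qed

section \<open>One iteration, seen from the ambient space\<close>

text \<open>The gradient is the image of the residual under the transposed Jacobian, so it is orthogonal to
  the kernel of \<open>J x\<close>; this is the quantitative form, with the residual measuring how much \<open>J x\<close>
  can shrink it.\<close>

lemma norm_lsq_grad_le:
  "(norm (lsq_grad F J y x))\<^sup>2 \<le> norm (F x - y) * norm (J x *v lsq_grad F J y x)"
proof -
  let ?g = "lsq_grad F J y x"
  have "(norm ?g)\<^sup>2 = inner (transpose (J x) *v (F x - y)) ?g"
    by (simp add: power2_norm_eq_inner lsq_grad_def)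
  also have "\<dots> = inner (F x - y) (J x *v ?g)"
    by (rule inner_transpose_mult)
  also have "\<dots> \<le> norm (F x - y) * norm (J x *v ?g)"
    by (rule norm_cauchy_schwarz)
  finally show ?thesis .
qed

lemma mult_lsq_grad_nonzero:
  assumes "lsq_grad F J y x \<noteq> 0"
  shows "0 < norm (J x *v lsq_grad F J y x)"
  using norm_lsq_grad_le[of F J y x] assms by (cases "J x *v lsq_grad F J y x = 0") auto

text \<open>All that the convergence proof needs to know about an iteration, with the Krylov space
  eliminated.  Here \<open>p i\<close> is the trial step and \<open>m i\<close> the predicted reduction after \<open>i\<close> reductions of
  the radius, and \<open>m i > 0\<close> has been used to clear the denominator of the acceptance test.\<close>

lemma lanczos_tr_step_ambient:
  fixes F :: "real^'n \<Rightarrow> real^'m" and y :: "real^'m"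
  defines "f \<equiv> lsq F y"
  assumes step: "lanczos_tr_step D F J y \<eta> \<gamma> q Cmin Cmax l x x'"
    and g: "g = lsq_grad F J y x" "g \<noteq> 0"
    and params: "0 < \<gamma>" "\<gamma> \<le> 1" "0 \<le> q" "q \<le> 1" "0 < Cmin"
    and K: "0 \<le> K" "\<And>h. norm (J x *v h) \<le> K * norm h"
  obtains \<Delta> N p m where
    "Cmin * norm (J x *v g) \<le> \<Delta>"
    "\<And>i. i \<le> N \<Longrightarrow> x + p i \<in> D"
    "\<And>i. i \<le> N \<Longrightarrow> norm (p i) \<le> K * (\<gamma> ^ i * \<Delta>)"
    "\<And>i. i \<le> N \<Longrightarrow> norm (J x *v g) * (\<gamma> ^ i * \<Delta>) / 2 \<le> m i"
    "\<And>i. i \<le> N \<Longrightarrow> m i \<le> - inner g (p i)"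
    "\<And>i. i < N \<Longrightarrow> f x - f (x + p i) < \<eta> * m i"
    "f x - f (x + p N) \<ge> \<eta> * m N"
    "x' = x + p N"
proof -
  from step obtain \<alpha> \<beta> P Q S \<Delta> N w \<mu> T H b p
    where l: "1 \<le> l"
      and T: "T = gklb_mat l \<alpha> \<beta>" and H: "H = transpose_mat T * T"
      and b: "b = cols_mult_transpose l Q (cols_mult l Q (S *\<^sub>v cols_mult_transpose l Q g))"
      and p: "p = (\<lambda>i. cols_mult l Q (S *\<^sub>v cols_mult_transpose l Q (cols_mult l Q (w i))))"
      and gk: "gklb (J x) g l \<alpha> \<beta> P Q" and S: "psd_sqrt H S"
      and \<Delta>l: "Cmin * norm (cols_mult l Q (S *\<^sub>v cols_mult_transpose l Q g)) \<le> \<Delta>"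
      and \<Delta>u: "\<Delta> \<le> min Cmax ((1 - q) / (mat_norm2 H)\<^sup>2)
          * norm (cols_mult l Q (S *\<^sub>v cols_mult_transpose l Q g))"
      and sol: "\<And>i. i \<le> N \<Longrightarrow> tr_solution l H b (f x) (\<gamma> ^ i * \<Delta>) (w i) (\<mu> i)"
      and D: "\<And>i. i \<le> N \<Longrightarrow> x + p i \<in> D"
      and rej: "\<And>i. i < N \<Longrightarrow> (f x - f (x + p i)) / (f x - tr_model H b (f x) (w i)) < \<eta>"
      and acc: "(f x - f (x + p N)) / (f x - tr_model H b (f x) (w N)) \<ge> \<eta>"
      and x': "x' = x + p N"
    unfolding lanczos_tr_step_def Let_def g(1)[symmetric] f_def by blast
  note Qo = gklb_orthonormal(1)[OF gk g(2)] and Po = gklb_orthonormal(2)[OF gk g(2)]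
  have Tc: "T \<in> carrier_mat l l" by (simp add: T gklb_mat_def)
  then have Hc: "H \<in> carrier_mat l l" by (simp add: H)
  have Ht: "transpose_mat H = H"
    using Tc by (simp add: H transpose_mult[of _ l l _ l])
  have Sc: "S \<in> carrier_mat l l" using psd_sqrt_carrier[OF S Hc] .
  have St: "transpose_mat S = S" using S by (simp add: psd_sqrt_def)
  define e where "e = cols_mult_transpose l Q g"
  have e: "e \<in> carrier_vec l" by (simp add: e_def)
  have S_norm: "vec_norm2 (S *\<^sub>v v) = norm (J x *v cols_mult l Q v)" if "v \<in> carrier_vec l" for v
    using psd_sqrt_norm[OF S[unfolded H] Tc that] gklb_mult_cols_mult[OF gk g(2) that] that Tc
    by (simp add: norm_cols_mult[OF Po] T)
  have b_eq: "b = S *\<^sub>v e"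
    using Sc e by (simp add: b e_def[symmetric] cols_mult_transpose_cols_mult[OF Qo])
  have bc: "b \<in> carrier_vec l" using Sc e by (simp add: b_eq)
  have norm_b: "vec_norm2 b = norm (J x *v g)"
    using S_norm[OF e] cols_mult_transpose_start[OF gk g(2) l] by (simp add: b_eq e_def)
  have norm_s: "norm (cols_mult l Q (S *\<^sub>v cols_mult_transpose l Q g)) = norm (J x *v g)"
    using norm_cols_mult[OF Qo, of "S *\<^sub>v e"] bc norm_b by (simp add: b_eq e_def)
  have Jg: "0 < norm (J x *v g)" using mult_lsq_grad_nonzero[of F J y x] g by simp
  have \<Delta>: "Cmin * norm (J x *v g) \<le> \<Delta>" using \<Delta>l norm_s by simp
  have "0 < Cmin * norm (J x *v g)" using Jg params by simp
  with \<Delta> have \<Delta>_pos: "0 < \<Delta>" by linarith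
  (* For H = 0 the quotient is zero by convention, but clearing the denominator remains correct. *)
  have "\<Delta> \<le> (1 - q) / (mat_norm2 H)\<^sup>2 * norm (J x *v g)"
    by (rule order.trans[OF \<Delta>u[unfolded norm_s]]) (intro mult_right_mono; simp)
  then have "(mat_norm2 H)\<^sup>2 * \<Delta> \<le> (1 - q) * norm (J x *v g)"
    using Jg params by (cases "mat_norm2 H = 0") (auto simp: field_simps split: if_splits)
  also have "\<dots> \<le> 1 * norm (J x *v g)"
    using params by (intro mult_right_mono) auto
  finally have H\<Delta>: "(mat_norm2 H)\<^sup>2 * \<Delta> \<le> norm (J x *v g)" by simp
  define m where "m i = f x - tr_model H b (f x) (w i)" for i
  have facts: "norm (p i) \<le> K * (\<gamma> ^ i * \<Delta>)" "norm (J x *v g) * (\<gamma> ^ i * \<Delta>) / 2 \<le> m i"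
    "m i \<le> - inner g (p i)" "0 < m i" if i: "i \<le> N" for i
  proof -
    have wc: "w i \<in> carrier_vec l" and wn: "vec_norm2 (w i) \<le> \<gamma> ^ i * \<Delta>"
      using sol[OF i] by (auto simp: tr_solution_def)
    have Swc: "S *\<^sub>v w i \<in> carrier_vec l" using Sc wc by simp
    have p_eq: "p i = cols_mult l Q (S *\<^sub>v w i)"
      by (simp add: p cols_mult_transpose_cols_mult[OF Qo wc])
    have "norm (p i) = norm (J x *v cols_mult l Q (w i))"
      using S_norm[OF wc] norm_cols_mult[OF Qo Swc] p_eq by simp
    also have "\<dots> \<le> K * vec_norm2 (w i)"
      using K(2)[of "cols_mult l Q (w i)"] norm_cols_mult[OF Qo wc] by simp
    also have "\<dots> \<le> K * (\<gamma> ^ i * \<Delta>)" by (intro mult_left_mono wn K)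
    finally show "norm (p i) \<le> K * (\<gamma> ^ i * \<Delta>)" .
    have \<gamma>: "0 < \<gamma> ^ i * \<Delta>" using params \<Delta>_pos by simp
    have "\<gamma> ^ i * \<Delta> \<le> \<Delta>"
      using params \<Delta>_pos by (simp add: mult_left_le_one_le power_le_one)
    then have "(mat_norm2 H)\<^sup>2 * (\<gamma> ^ i * \<Delta>) \<le> (mat_norm2 H)\<^sup>2 * \<Delta>"
      by (intro mult_left_mono) auto
    then show mi: "norm (J x *v g) * (\<gamma> ^ i * \<Delta>) / 2 \<le> m i"
      using tr_solution_reduction[OF Hc Ht bc sol[OF i]] \<gamma> H\<Delta> by (simp add: norm_b m_def)
    have "inner g (p i) = (S *\<^sub>v w i) \<bullet> e"
      using inner_cols_mult[OF Swc, of Q g] by (simp add: p_eq e_def inner_commute)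
    also have "\<dots> = w i \<bullet> b"
      using scalar_prod_mult_mat_vec[OF Sc wc e] St by (simp add: b_eq)
    finally show "m i \<le> - inner g (p i)"
      by (simp add: m_def tr_model_eq[OF Hc Ht wc])
    have "0 < norm (J x *v g) * (\<gamma> ^ i * \<Delta>) / 2" using Jg \<gamma> by simp
    with mi show "0 < m i" by linarith
  qed
  show thesis
  proof (rule that[of \<Delta> N p m])
    show "f x - f (x + p i) < \<eta> * m i" if "i < N" for i
      using rej[OF that] facts(4)[of i] that by (simp add: m_def[symmetric] field_simps)
    show "f x - f (x + p N) \<ge> \<eta> * m N"
      using acc facts(4)[of N] by (simp add: m_def[symmetric] field_simps)
  qed (use \<Delta> D facts x' in auto)
qed

section \<open>Descent\<close>

text \<open>In the application \<open>U\<close> surrounds a level set and may fail to be convex, so the segment is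
  required to lie in it separately.\<close>

lemma lipschitz_gradient_descent:
  fixes f :: "'a::real_inner \<Rightarrow> real" and G :: "'a \<Rightarrow> 'a"
  assumes f: "\<And>z. z \<in> U \<Longrightarrow> (f has_derivative (\<lambda>h. inner (G z) h)) (at z)"
    and G: "L-lipschitz_on U G"
    and t: "0 \<le> t" and seg: "\<And>s. 0 \<le> s \<Longrightarrow> s \<le> t \<Longrightarrow> x + s *\<^sub>R p \<in> U"
  shows "f (x + t *\<^sub>R p) \<le> f x + t * inner (G x) p + L / 2 * t\<^sup>2 * (norm p)\<^sup>2"
proof -
  (* The Lipschitz bound says precisely that the derivative of phi is nonpositive. *)
  define \<phi> where "\<phi> s = f (x + s *\<^sub>R p) - s * inner (G x) p - L / 2 * s\<^sup>2 * (norm p)\<^sup>2" for s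
  have "\<phi> t \<le> \<phi> 0"
  proof (rule DERIV_nonpos_imp_nonincreasing[OF t])
    fix s assume s: "0 \<le> s" "s \<le> t"
    let ?d = "inner (G (x + s *\<^sub>R p)) p - inner (G x) p - L * s * (norm p)\<^sup>2"
    have "((\<lambda>s. f (x + s *\<^sub>R p)) has_derivative (\<lambda>h. inner (G (x + s *\<^sub>R p)) (h *\<^sub>R p))) (at s)"
      by (rule has_derivative_compose[where f = "\<lambda>s. x + s *\<^sub>R p", OF _ f[OF seg[OF s]]])
        (auto intro!: derivative_eq_intros)
    then have "((\<lambda>s. f (x + s *\<^sub>R p)) has_real_derivative inner (G (x + s *\<^sub>R p)) p) (at s)"
      by (simp add: has_field_derivative_def mult.commute[of _ "inner _ _"])
    then have "(\<phi> has_real_derivative ?d) (at s)"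
      unfolding \<phi>_def by (auto intro!: derivative_eq_intros simp: power2_eq_square)
    moreover have "?d \<le> 0"
    proof -
      have "inner (G (x + s *\<^sub>R p)) p - inner (G x) p = inner (G (x + s *\<^sub>R p) - G x) p"
        by (simp add: inner_diff_left)
      also have "\<dots> \<le> norm (G (x + s *\<^sub>R p) - G x) * norm p" by (rule norm_cauchy_schwarz)
      also have "\<dots> \<le> L * norm (s *\<^sub>R p) * norm p"
        using lipschitz_onD[OF G seg[OF s], of x] seg[of 0] t
        by (intro mult_right_mono) (auto simp: dist_norm)
      finally show ?thesis using s by (simp add: power2_eq_square algebra_simps)
    qed
    ultimately show "\<exists>y. (\<phi> has_real_derivative y) (at s) \<and> y \<le> 0" by blast
  qed
  then show ?thesis by (simp add: \<phi>_def)
qed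

text \<open>A short step cannot leave \<open>U\<close>.  Up to a first exit time \<open>t0\<close> the descent estimate applies and
  keeps \<open>f\<close> below \<open>c\<close>, so the exit point is a limit of points of the level set; but the closure of
  the level set lies in \<open>U\<close>.\<close>

lemma segment_in_neighbourhood:
  fixes f :: "'a::real_inner \<Rightarrow> real" and G :: "'a \<Rightarrow> 'a"
  assumes f: "\<And>z. z \<in> U \<Longrightarrow> (f has_derivative (\<lambda>h. inner (G z) h)) (at z)"
    and G: "L-lipschitz_on U G"
    and U: "open U" "closure {z \<in> U. f z \<le> c} \<subseteq> U"
    and x: "x \<in> U" "f x \<le> c"
    and p: "L / 2 * (norm p)\<^sup>2 \<le> - inner (G x) p"
    and t: "0 \<le> t" "t \<le> 1"
  shows "x + t *\<^sub>R p \<in> U"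
proof (rule ccontr)
  assume nt: "x + t *\<^sub>R p \<notin> U"
  define C where "C = {0..1} \<inter> (\<lambda>s. x + s *\<^sub>R p) -` (- U)"
  have "closed ((\<lambda>s. x + s *\<^sub>R p) -` (- U))"
    using U(1) by (intro continuous_closed_vimage) (auto intro!: continuous_intros)
  then have "compact C" unfolding C_def by (intro compact_Int_closed) auto
  moreover have "C \<noteq> {}" using nt t by (auto simp: C_def)
  ultimately obtain t0 where t0: "t0 \<in> C" and first: "\<And>s. s \<in> C \<Longrightarrow> t0 \<le> s"
    using compact_attains_inf by meson
  have t01: "0 \<le> t0" "t0 \<le> 1" and t0U: "x + t0 *\<^sub>R p \<notin> U" using t0 by (auto simp: C_def)
  have pos: "0 < t0" using t01 t0U x by (cases "t0 = 0") auto
  have before: "x + s *\<^sub>R p \<in> U" if "0 \<le> s" "s < t0" for s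
    using first[of s] that t01 by (force simp: C_def)
  have level: "x + s *\<^sub>R p \<in> {z \<in> U. f z \<le> c}" if s: "0 \<le> s" "s < t0" for s
  proof -
    have "f (x + s *\<^sub>R p) \<le> f x + s * inner (G x) p + L / 2 * s\<^sup>2 * (norm p)\<^sup>2"
      using s by (intro lipschitz_gradient_descent[OF f G]) (auto intro: before)
    also have "L / 2 * s\<^sup>2 * (norm p)\<^sup>2 \<le> s * (L / 2 * (norm p)\<^sup>2)"
    proof -
      have "s\<^sup>2 \<le> s" using s t01 by (simp add: power2_eq_square mult_left_le)
      then show ?thesis
        using mult_right_mono[of "s\<^sup>2" s "L / 2 * (norm p)\<^sup>2"] lipschitz_on_nonneg[OF G]
        by (simp add: algebra_simps)
    qed
    also have "f x + s * inner (G x) p + \<dots> \<le> f x + s * inner (G x) p + s * (- inner (G x) p)"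
      using p s by (intro add_left_mono mult_left_mono) auto
    finally show ?thesis using before[OF s] x by simp
  qed
  have "((\<lambda>s. x + s *\<^sub>R p) \<longlongrightarrow> x + t0 *\<^sub>R p) (at_left t0)"
    by (intro tendsto_intros)
  moreover have "\<forall>\<^sub>F s in at_left t0. x + s *\<^sub>R p \<in> closure {z \<in> U. f z \<le> c}"
    using eventually_at_left[OF pos] level closure_subset
    by (smt (verit, best) eventually_at_left_field pos subsetD)
  ultimately have "x + t0 *\<^sub>R p \<in> closure {z \<in> U. f z \<le> c}"
    by (intro Lim_in_closed_set[OF closed_closure]) auto
  with U(2) t0U show False by blast
qed

text \<open>In the bound, \<open>Cmin\<close> accounts for acceptance of the initial radius and \<open>\<gamma>\<close> times the threshold
  \<open>(1 - \<eta>) / ((L + 1) K\<^sup>2)\<close> for acceptance after a rejection: the last rejected radius exceeds the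
  threshold times \<open>\<parallel>J x g\<parallel>\<close>.  The Lipschitz constant may be zero, which is why \<open>L + 1\<close> appears.\<close>

lemma lanczos_tr_step_decrease:
  fixes F :: "real^'n \<Rightarrow> real^'m" and y :: "real^'m"
  defines "f \<equiv> lsq F y"
  assumes step: "lanczos_tr_step D F J y \<eta> \<gamma> q Cmin Cmax l x x'"
    and g: "g = lsq_grad F J y x" "g \<noteq> 0"
    and params: "0 < \<eta>" "\<eta> < 1" "0 < \<gamma>" "\<gamma> < 1" "0 \<le> q" "q \<le> 1" "0 < Cmin"
    and K: "0 < K" "\<And>h. norm (J x *v h) \<le> K * norm h"
    and f: "\<And>z. z \<in> U \<Longrightarrow> (f has_derivative (\<lambda>h. inner (lsq_grad F J y z) h)) (at z)"
    and G: "L-lipschitz_on U (lsq_grad F J y)"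
    and U: "open U" "closure {z \<in> U. f z \<le> c} \<subseteq> U"
    and x: "x \<in> U" "f x \<le> c"
  shows "x' \<in> D"
    and "\<eta> / 2 * min Cmin (\<gamma> * (1 - \<eta>) / ((L + 1) * K\<^sup>2)) * (norm (J x *v g))\<^sup>2 \<le> f x - f x'"
proof -
  define a where "a = norm (J x *v g)"
  define \<kappa> where "\<kappa> = (1 - \<eta>) / ((L + 1) * K\<^sup>2)"
  have L: "0 \<le> L" using lipschitz_on_nonneg[OF G] .
  have \<kappa>: "0 < \<kappa>" using params K L by (simp add: \<kappa>_def)
  obtain \<Delta> N p m where
    \<Delta>: "Cmin * a \<le> \<Delta>" and D: "\<And>i. i \<le> N \<Longrightarrow> x + p i \<in> D"
    and p: "\<And>i. i \<le> N \<Longrightarrow> norm (p i) \<le> K * (\<gamma> ^ i * \<Delta>)"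
    and m: "\<And>i. i \<le> N \<Longrightarrow> a * (\<gamma> ^ i * \<Delta>) / 2 \<le> m i"
    and gp: "\<And>i. i \<le> N \<Longrightarrow> m i \<le> - inner g (p i)"
    and rej: "\<And>i. i < N \<Longrightarrow> f x - f (x + p i) < \<eta> * m i"
    and acc: "f x - f (x + p N) \<ge> \<eta> * m N" and x': "x' = x + p N"
    using lanczos_tr_step_ambient[OF step g, of K] params K
    unfolding f_def a_def by (metis less_imp_le)
  have a: "0 < a" using mult_lsq_grad_nonzero[of F J y x] g by (simp add: a_def)
  have \<Delta>_pos: "0 < \<Delta>" using \<Delta> a params by (smt (verit) mult_pos_pos)
  show "x' \<in> D" using D x' by simp
  have large: "\<kappa> * a < \<gamma> ^ i * \<Delta>" if i: "i < N" for i
  proof (rule ccontr)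
    assume "\<not> \<kappa> * a < \<gamma> ^ i * \<Delta>"
    then have small: "\<gamma> ^ i * \<Delta> \<le> \<kappa> * a" by simp
    define r where "r = \<gamma> ^ i * \<Delta>"
    have r: "0 < r" using params \<Delta>_pos by (simp add: r_def)
    have "(norm (p i))\<^sup>2 \<le> (K * r)\<^sup>2"
      using p[of i] i unfolding r_def by (intro power_mono) auto
    then have "L / 2 * (norm (p i))\<^sup>2 \<le> (L + 1) / 2 * (K * r)\<^sup>2"
      using L by (intro mult_mono) auto
    also have "\<dots> = (L + 1) * K\<^sup>2 * r / 2 * r" by (simp add: power2_eq_square)
    also have "\<dots> \<le> (L + 1) * K\<^sup>2 * (\<kappa> * a) / 2 * r"
      using small r L K unfolding r_def[symmetric]
      by (intro mult_right_mono divide_right_mono mult_left_mono) auto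
    also have "\<dots> = (1 - \<eta>) * (a * r / 2)"
      using L K by (simp add: \<kappa>_def)
    also have "\<dots> \<le> (1 - \<eta>) * m i"
      using m[of i] i params by (intro mult_left_mono) (auto simp: r_def)
    (* The excess of f over the model is at most the fraction 1 - \<eta> of the predicted reduction,
       so the step stays in U and passes the acceptance test. *)
    finally have quad: "L / 2 * (norm (p i))\<^sup>2 \<le> (1 - \<eta>) * m i" .
    have "0 < a * r / 2" using a r by simp
    then have mi: "0 < m i" using m[of i] i by (simp add: r_def)
    then have "(1 - \<eta>) * m i \<le> m i" using params by (simp add: algebra_simps)
    then have "L / 2 * (norm (p i))\<^sup>2 \<le> - inner (lsq_grad F J y x) (p i)"
      using quad gp[of i] i g by simp
    then have "x + s *\<^sub>R p i \<in> U" if "0 \<le> s" "s \<le> 1" for s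
      using that by (intro segment_in_neighbourhood[OF f G U x]) auto
    then have "f (x + 1 *\<^sub>R p i) \<le> f x + 1 * inner (lsq_grad F J y x) (p i) + L / 2 * 1\<^sup>2 * (norm (p i))\<^sup>2"
      by (intro lipschitz_gradient_descent[OF f G]) auto
    then have "f (x + p i) \<le> f x - m i + (1 - \<eta>) * m i"
      using gp[of i] i g quad by simp
    then show False using rej[OF i] by (simp add: algebra_simps)
  qed
  (* A positive N means that the radius with exponent N - 1 was rejected. *)
  have "min Cmin (\<gamma> * \<kappa>) * a \<le> \<gamma> ^ N * \<Delta>"
  proof (cases N)
    case 0
    have "min Cmin (\<gamma> * \<kappa>) * a \<le> Cmin * a" using a by (intro mult_right_mono) auto
    then show ?thesis using \<Delta> 0 by simp
  next
    case (Suc i)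
    have "min Cmin (\<gamma> * \<kappa>) * a \<le> \<gamma> * \<kappa> * a" using a by (intro mult_right_mono) auto
    also have "\<dots> \<le> \<gamma> * (\<gamma> ^ i * \<Delta>)"
      using large[of i] Suc params by (simp add: mult.assoc)
    finally show ?thesis using Suc by (simp add: mult.assoc)
  qed
  then have "a * (min Cmin (\<gamma> * \<kappa>) * a) / 2 \<le> m N"
    using m[of N] a by (smt (verit) divide_right_mono mult_left_mono order_refl)
  then have "\<eta> * (a * (min Cmin (\<gamma> * \<kappa>) * a) / 2) \<le> \<eta> * m N"
    using params by (intro mult_left_mono) auto
  also have "\<dots> \<le> f x - f x'" using acc x' by simp
  finally show "\<eta> / 2 * min Cmin (\<gamma> * (1 - \<eta>) / ((L + 1) * K\<^sup>2)) * (norm (J x *v g))\<^sup>2 \<le> f x - f x'"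
    by (simp add: a_def \<kappa>_def power2_eq_square mult_ac)
qed

section \<open>Convergence\<close>

theorem corollary5p1:
  fixes D U :: "(real^'n) set"
    and F :: "real^'n \<Rightarrow> real^'m"
    and J :: "real^'n \<Rightarrow> real^'n^'m"
    and y :: "real^'m"
    and x0 :: "real^'n"
    and x :: "nat \<Rightarrow> real^'n"
    and l :: "nat \<Rightarrow> nat"
    and \<sigma> :: "nat \<Rightarrow> nat \<Rightarrow> real"
    and \<eta> \<gamma> q Cmin Cmax KJ L \<tau> :: real
  assumes dims: "CARD('n) \<le> CARD('m)"
    and deriv: "\<And>z. z \<in> D \<Longrightarrow> (F has_derivative (\<lambda>h. J z *v h)) (at z within D)"
    and J_cont: "continuous_on D J"
    and params: "0 < \<eta>" "\<eta> < 1" "0 < \<gamma>" "\<gamma> < 1" "0 < q" "q < 1" "0 < Cmin" "Cmin < Cmax"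
    and run: "lanczos_tr_run D F J y \<eta> \<gamma> q Cmin Cmax l x"
    and start: "x 0 = x0"
    and neighbourhood: "open U" "closure (lsq_level_set D F y x0) \<subseteq> U" "U \<subseteq> D"
    and J_bound: "0 < KJ" "\<And>z. z \<in> U \<Longrightarrow> onorm (\<lambda>h. J z *v h) \<le> KJ"
    and grad_lipschitz: "L-lipschitz_on U (lsq_grad F J y)"
    and full_rank: "\<And>z. z \<in> U \<Longrightarrow> rank (J z) = CARD('n)"
    and sing_vals: "\<And>k. singular_values (J (x k)) (\<sigma> k)"
    and sing_bound: "0 < \<tau>"
      "\<And>k. lsq_grad F J y (x k) \<noteq> 0 \<Longrightarrow> \<sigma> k (l k) > \<tau>"
    and bdd: "bdd_below (lsq F y ` lsq_level_set D F y x0)"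
  shows "liminf (\<lambda>k. ereal (norm (lsq_grad F J y (x k)))) = 0"
proof -
  define f where "f = lsq F y"
  define G where "G = lsq_grad F J y"
  define \<L> where "\<L> = lsq_level_set D F y x0"
  define \<kappa> where "\<kappa> = \<eta> / 2 * min Cmin (\<gamma> * (1 - \<eta>) / ((L + 1) * KJ\<^sup>2))"
  (* M bounds the squared residuals along the run; the summand 1 keeps it positive. *)
  define M where "M = 2 * f x0 + 1"
  have fpos: "0 \<le> f z" for z by (simp add: f_def lsq_def)
  have L: "0 \<le> L" using lipschitz_on_nonneg[OF grad_lipschitz] .
  have \<kappa>: "0 < \<kappa>" using params J_bound(1) L by (simp add: \<kappa>_def)
  have M: "0 < M" using fpos[of x0] by (simp add: M_def)
  have D_U: "z \<in> D" if "z \<in> U" for z using neighbourhood(3) that by blast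
  have \<L>_U: "\<L> \<subseteq> U" using neighbourhood(2) closure_subset unfolding \<L>_def by blast
  have "{z \<in> U. f z \<le> f x0} \<subseteq> \<L>"
    using D_U by (auto simp: \<L>_def lsq_level_set_def f_def)
  then have closure_U: "closure {z \<in> U. f z \<le> f x0} \<subseteq> U"
    using closure_mono neighbourhood(2) unfolding \<L>_def by blast
  have f_deriv: "(f has_derivative (\<lambda>h. inner (G z) h)) (at z)" if "z \<in> U" for z
  proof -
    have "(F has_derivative (\<lambda>h. J z *v h)) (at z within U)"
      using deriv[OF D_U[OF that]] neighbourhood(3) by (rule has_derivative_subset)
    then have "(f has_derivative (\<lambda>h. inner (G z) h)) (at z within U)"
      unfolding f_def G_def by (rule lsq_grad_is_gradient)
    then show ?thesis using at_within_open[OF that neighbourhood(1)] by simp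
  qed
  have J_le: "norm (J z *v h) \<le> KJ * norm h" if "z \<in> U" for z h
  proof -
    have "norm (J z *v h) \<le> onorm (\<lambda>h. J z *v h) * norm h"
      by (rule onorm) (rule matrix_vector_mul_bounded_linear)
    also have "\<dots> \<le> KJ * norm h" using J_bound(2)[OF that] by (rule mult_right_mono) simp
    finally show ?thesis .
  qed
  have step: "x (Suc k) \<in> \<L> \<and> \<kappa> / M * norm (G (x k)) ^ 4 \<le> f (x k) - f (x (Suc k))"
    if xk: "x k \<in> \<L>" for k
  proof (cases "G (x k) = 0")
    case True
    then have "x (Suc k) = x k" using run unfolding lanczos_tr_run_def G_def by metis
    then show ?thesis using xk True by simp
  next
    case False
    define g where "g = G (x k)"
    have g: "g = lsq_grad F J y (x k)" "g \<noteq> 0" using False by (auto simp: g_def G_def)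
    have st: "lanczos_tr_step D F J y \<eta> \<gamma> q Cmin Cmax (l k) (x k) (x (Suc k))"
      using run False unfolding lanczos_tr_run_def G_def by metis
    have xU: "x k \<in> U" using xk \<L>_U by blast
    have fx: "f (x k) \<le> f x0" using xk by (simp add: \<L>_def lsq_level_set_def f_def)
    note dec = lanczos_tr_step_decrease[OF st g params(1-4) less_imp_le[OF params(5)] less_imp_le[OF params(6)] params(7)
        J_bound(1) J_le[OF xU] f_deriv[unfolded f_def G_def] grad_lipschitz neighbourhood(1)
        closure_U[unfolded f_def] xU fx[unfolded f_def], folded f_def \<kappa>_def]
    have "norm g ^ 4 = ((norm g)\<^sup>2)\<^sup>2" by simp
    also have "\<dots> \<le> (norm (F (x k) - y) * norm (J (x k) *v g))\<^sup>2"
      using norm_lsq_grad_le[of F J y "x k"] g by (intro power_mono) auto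
    also have "\<dots> = 2 * f (x k) * (norm (J (x k) *v g))\<^sup>2"
      by (simp add: f_def lsq_def power_mult_distrib)
    also have "\<dots> \<le> M * (norm (J (x k) *v g))\<^sup>2"
      using fx by (intro mult_right_mono) (auto simp: M_def)
    finally have "norm g ^ 4 / M \<le> (norm (J (x k) *v g))\<^sup>2"
      using M by (simp add: field_simps)
    then have "\<kappa> * (norm g ^ 4 / M) \<le> \<kappa> * (norm (J (x k) *v g))\<^sup>2"
      using \<kappa> by (intro mult_left_mono) auto
    then have dec': "\<kappa> / M * norm g ^ 4 \<le> f (x k) - f (x (Suc k))"
      using dec(2) by simp
    have "0 \<le> \<kappa> / M * norm g ^ 4" using \<kappa> M by simp
    then have "f (x (Suc k)) \<le> f x0" using dec' fx by linarith
    then have "x (Suc k) \<in> \<L>" using dec(1) by (simp add: \<L>_def lsq_level_set_def f_def)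
    with dec' show ?thesis by (simp add: g_def)
  qed
  have in_\<L>: "x k \<in> \<L>" for k
  proof (induction k)
    case 0
    then show ?case using run start by (auto simp: \<L>_def lsq_level_set_def lanczos_tr_run_def)
  qed (use step in blast)
  have "(\<Sum>k<n. \<kappa> / M * norm (G (x k)) ^ 4) \<le> f x0" for n
  proof -
    have "(\<Sum>k<n. \<kappa> / M * norm (G (x k)) ^ 4) \<le> (\<Sum>k<n. f (x k) - f (x (Suc k)))"
      by (intro sum_mono) (use step in_\<L> in blast)
    also have "\<dots> = f (x 0) - f (x n)" by (rule sum_lessThan_telescope')
    finally show ?thesis using fpos[of "x n"] start by simp
  qed
  then have "summable (\<lambda>k. \<kappa> / M * norm (G (x k)) ^ 4)"
    using \<kappa> M by (intro summableI_nonneg_bounded[where x = "f x0"]) auto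
  then have "(\<lambda>k. M / \<kappa> * (\<kappa> / M * norm (G (x k)) ^ 4)) \<longlonglongrightarrow> M / \<kappa> * 0"
    by (intro tendsto_intros summable_LIMSEQ_zero)
  then have "(\<lambda>k. norm (G (x k)) ^ 4) \<longlonglongrightarrow> 0" using \<kappa> M by simp
  then have "(\<lambda>k. root 4 (norm (G (x k)) ^ 4)) \<longlonglongrightarrow> root 4 0"
    by (intro tendsto_real_root)
  then have "(\<lambda>k. norm (G (x k))) \<longlonglongrightarrow> 0"
    by (simp add: real_root_power_cancel)
  then have "(\<lambda>k. ereal (norm (G (x k)))) \<longlonglongrightarrow> ereal 0" by simp
  then show ?thesis
    unfolding G_def zero_ereal_def by (intro lim_imp_Liminf) auto
qed

end
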